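(* Let $(E_1,\mu_1,\mathcal{E}_1,\mathcal{D}(\mathcal{E}_1))$ and $(E_2,\mu_2,\mathcal{E}_2,\mathcal{D}(\mathcal{E}_2))$ be quasi-regular Dirichlet spaces and let $\varphi:E_1\to E_2$ be a quasi-homeomorphism from the first to the second. If $(E_1,\mu_1,\mathcal{E}_1,\mathcal{D}(\mathcal{E}_1))$ satisfies a logarithmic Sobolev inequality with constant $C$, then $(E_2,\mu_2,\mathcal{E}_2,\mathcal{D}(\mathcal{E}_2))$ satisfies a logarithmic Sobolev inequality, and its constant can be chosen to be the same $C$; that is, $$\int_{E_2} f^2\log f^2\,d\mu_2-\Big(\int_{E_2} f^2\,d\mu_2\Big)\log\Big(\int_{E_2} f^2\,d\mu_2\Big)\leqslant C\,\mathcal{E}_2(f,f)\qquad\text{for all } f\in\mathcal{D}(\mathcal{E}_2).$$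
   Context: A quasi-regular Dirichlet space $(E,\mu,\mathcal{E},\mathcal{D}(\mathcal{E}))$ consists of a Hausdorff topological space $E$ with a countable base, a $\sigma$-finite positive Borel measure $\mu$ on $E$, and a quasi-regular (symmetric) Dirichlet form $\mathcal{E}$ on real $L^2(E,\mu)$ with domain $\mathcal{D}(\mathcal{E})\subseteq L^2(E,\mu)$, in the standard sense. The $\mathcal{E}$-norm is $\|f\|_{\mathcal{E}}^2=\|f\|_{L^2(E,\mu)}^2+\mathcal{E}(f,f)$. For a closed $F\subseteq E$ put $\mathcal{D}(\mathcal{E})_F=\{f\in\mathcal{D}(\mathcal{E}): f=0\ \mu\text{-a.e. on }F^c\}$. An $\mathcal{E}$-nest is an increasing sequence $\{F_k\}_{k\ge1}$ of closed subsets of $E$ such that $\bigcup_k\mathcal{D}(\mathcal{E})_{F_k}$ is dense in $\mathcal{D}(\mathcal{E})$ in the $\mathcal{E}$-norm. A (measurable) map $\varphi:E_1\to E_2$ is a quasi-homeomorphism from $(E_1,\mu_1,\mathcal{E}_1,\mathcal{D}(\mathcal{E}_1))$ to $(E_2,\mu_2,\mathcal{E}_2,\mathcal{D}(\mathcal{E}_2))$ if: (1) $\mu_2=\varphi_{\#}\mu_1$ (pushforward); (2) there are an $\mathcal{E}_1$-nest $\{F_1^k\}_k$ and an $\mathcal{E}_2$-nest $\{F_2^k\}_k$ such that for each $k$ the restriction of $\varphi$ to $F_1^k$ is a homeomorphism from $F_1^k$ onto $F_2^k$; (3) for all $f,h\in\mathcal{D}(\mathcal{E}_2)$ one has $f\circ\varphi,h\circ\varphi\in\mathcal{D}(\mathcal{E}_1)$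 and $\mathcal{E}_2(f,h)=\mathcal{E}_1(f\circ\varphi,h\circ\varphi)$. The space $(E,\mu,\mathcal{E},\mathcal{D}(\mathcal{E}))$ satisfies a logarithmic Sobolev inequality with constant $C$ if $\int_E f^2\log f^2\,d\mu-\left(\int_E f^2\,d\mu\right)\log\left(\int_E f^2\,d\mu\right)\leqslant C\,\mathcal{E}(f,f)$ for every $f\in\mathcal{D}(\mathcal{E})$, with the convention $0\log 0=0$. *)

theory Defs
  imports "HOL-Analysis.Analysis"
begin

text \<open>
  Elements of L2 are represented by measurable functions rather than by classes modulo
  \<open>\<mu>\<close>-null sets. A domain \<open>D\<close> is accordingly a set of functions that is closed under change
  of representative, and a form \<open>\<E>\<close> is a function of two representatives, relevant only on
  \<open>D\<close>, whose value does not depend on the choice of representatives.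
\<close>

type_synonym 'a bform = "('a \<Rightarrow> real) \<Rightarrow> ('a \<Rightarrow> real) \<Rightarrow> real"

definition L2_functions :: "'a measure \<Rightarrow> ('a \<Rightarrow> real) set" where
  "L2_functions M = {f \<in> borel_measurable M. integrable M (\<lambda>x. (f x)\<^sup>2)}"

definition form_norm :: "'a measure \<Rightarrow> 'a bform \<Rightarrow> ('a \<Rightarrow> real) \<Rightarrow> real" where
  "form_norm M \<E> f = sqrt ((\<integral>x. (f x)\<^sup>2 \<partial>M) + \<E> f f)"

definition form_dense :: "'a measure \<Rightarrow> 'a bform \<Rightarrow> ('a \<Rightarrow> real) set \<Rightarrow> ('a \<Rightarrow> real) set \<Rightarrow> bool" where
  "form_dense M \<E> D S \<longleftrightarrow>
     S \<subseteq> D \<and> (\<forall>f\<in>D. \<forall>e>0. \<exists>g\<in>S. form_norm M \<E> (\<lambda>x. f x - g x) < e)"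

locale dirichlet_space = sigma_finite_measure M
  for M :: "'a::{t2_space, second_countable_topology} measure" +
  fixes \<E> :: "'a bform" and D :: "('a \<Rightarrow> real) set"
  assumes sets_eq_borel: "sets M = sets borel"
    and dom_L2: "D \<subseteq> L2_functions M"
    and dom_AE_cong:
      "\<And>f g. \<lbrakk>f \<in> D; g \<in> borel_measurable M; AE x in M. f x = g x\<rbrakk> \<Longrightarrow> g \<in> D"
    and form_AE_cong:
      "\<And>f g h. \<lbrakk>f \<in> D; g \<in> D; h \<in> D; AE x in M. f x = g x\<rbrakk> \<Longrightarrow> \<E> f h = \<E> g h"
    and dom_zero: "(\<lambda>_. 0) \<in> D"
    and dom_add: "\<And>f g. \<lbrakk>f \<in> D; g \<in> D\<rbrakk> \<Longrightarrow> (\<lambda>x. f x + g x) \<in> D"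
    and dom_scale: "\<And>c f. f \<in> D \<Longrightarrow> (\<lambda>x. c * f x) \<in> D"
    and dom_dense:
      "\<And>f e. \<lbrakk>f \<in> L2_functions M; e > 0\<rbrakk> \<Longrightarrow> \<exists>g\<in>D. sqrt (\<integral>x. (f x - g x)\<^sup>2 \<partial>M) < e"
    and form_sym: "\<And>f g. \<lbrakk>f \<in> D; g \<in> D\<rbrakk> \<Longrightarrow> \<E> f g = \<E> g f"
    and form_add:
      "\<And>f g h. \<lbrakk>f \<in> D; g \<in> D; h \<in> D\<rbrakk> \<Longrightarrow> \<E> (\<lambda>x. f x + g x) h = \<E> f h + \<E> g h"
    and form_scale: "\<And>c f h. \<lbrakk>f \<in> D; h \<in> D\<rbrakk> \<Longrightarrow> \<E> (\<lambda>x. c * f x) h = c * \<E> f h"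
    and form_nonneg: "\<And>f. f \<in> D \<Longrightarrow> \<E> f f \<ge> 0"
    and form_closed:
      "\<And>u. \<lbrakk>\<And>n::nat. u n \<in> D;
            \<And>e. e > 0 \<Longrightarrow> \<exists>N. \<forall>m\<ge>N. \<forall>n\<ge>N. form_norm M \<E> (\<lambda>x. u m x - u n x) < e\<rbrakk>
        \<Longrightarrow> \<exists>v\<in>D. (\<lambda>n. form_norm M \<E> (\<lambda>x. u n x - v x)) \<longlonglongrightarrow> 0"
    and dom_unit_contraction: "\<And>f. f \<in> D \<Longrightarrow> (\<lambda>x. min (max (f x) 0) 1) \<in> D"
    and form_unit_contraction:
      "\<And>f. f \<in> D \<Longrightarrow> \<E> (\<lambda>x. min (max (f x) 0) 1) (\<lambda>x. min (max (f x) 0) 1) \<le> \<E> f f"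

definition dom_on :: "'a measure \<Rightarrow> ('a \<Rightarrow> real) set \<Rightarrow> 'a set \<Rightarrow> ('a \<Rightarrow> real) set" where
  "dom_on M D F = {f \<in> D. AE x in M. x \<notin> F \<longrightarrow> f x = 0}"

definition nest ::
  "'a::topological_space measure \<Rightarrow> 'a bform \<Rightarrow> ('a \<Rightarrow> real) set \<Rightarrow> (nat \<Rightarrow> 'a set) \<Rightarrow> bool" where
  "nest M \<E> D F \<longleftrightarrow>
     incseq F \<and> (\<forall>k. closed (F k)) \<and> form_dense M \<E> D (\<Union>k. dom_on M D (F k))"

definition exceptional ::
  "'a::topological_space measure \<Rightarrow> 'a bform \<Rightarrow> ('a \<Rightarrow> real) set \<Rightarrow> 'a set \<Rightarrow> bool" where
  "exceptional M \<E> D N \<longleftrightarrow> (\<exists>F. nest M \<E> D F \<and> N \<subseteq> (\<Inter>k. - F k))"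

text \<open>
  Quasi-continuous functions need only be defined quasi-everywhere; here they are total, with
  arbitrary values (possibly not measurable) off the union of the nest.
\<close>

definition quasi_continuous ::
  "'a::topological_space measure \<Rightarrow> 'a bform \<Rightarrow> ('a \<Rightarrow> real) set \<Rightarrow> ('a \<Rightarrow> real) \<Rightarrow> bool" where
  "quasi_continuous M \<E> D f \<longleftrightarrow> (\<exists>F. nest M \<E> D F \<and> (\<forall>k. continuous_on (F k) f))"

definition qc_version ::
  "'a::topological_space measure \<Rightarrow> 'a bform \<Rightarrow> ('a \<Rightarrow> real) set \<Rightarrow>
   ('a \<Rightarrow> real) \<Rightarrow> ('a \<Rightarrow> real) \<Rightarrow> bool" where
  "qc_version M \<E> D f f' \<longleftrightarrow> quasi_continuous M \<E> D f' \<and> (AE x in M. f' x = f x)"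

text \<open>Quasi-regularity in the sense of Ma and Roeckner.\<close>

locale quasi_regular_dirichlet_space = dirichlet_space +
  assumes compact_nest: "\<exists>F. nest M \<E> D F \<and> (\<forall>k. compact (F k))"
    and qc_dense:
      "\<exists>S. form_dense M \<E> D S \<and> (\<forall>f\<in>S. \<exists>f'. qc_version M \<E> D f f')"
    and qc_separating:
      "\<exists>(u :: nat \<Rightarrow> _ \<Rightarrow> real) u' N. (\<forall>n. u n \<in> D \<and> qc_version M \<E> D (u n) (u' n)) \<and>
         exceptional M \<E> D N \<and>
         (\<forall>x y. x \<notin> N \<and> y \<notin> N \<and> x \<noteq> y \<longrightarrow> (\<exists>n. u' n x \<noteq> u' n y))"

definition quasi_homeomorphism ::
  "'a::topological_space measure \<Rightarrow> 'a bform \<Rightarrow> ('a \<Rightarrow> real) set \<Rightarrow>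
   'b::topological_space measure \<Rightarrow> 'b bform \<Rightarrow> ('b \<Rightarrow> real) set \<Rightarrow> ('a \<Rightarrow> 'b) \<Rightarrow> bool" where
  "quasi_homeomorphism M1 \<E>1 D1 M2 \<E>2 D2 \<phi> \<longleftrightarrow>
     \<phi> \<in> measurable M1 M2 \<and>
     M2 = distr M1 M2 \<phi> \<and>
     (\<exists>F1 F2. nest M1 \<E>1 D1 F1 \<and> nest M2 \<E>2 D2 F2 \<and>
        (\<forall>k. \<exists>\<psi>. homeomorphism (F1 k) (F2 k) \<phi> \<psi>)) \<and>
     (\<forall>f\<in>D2. \<forall>h\<in>D2. f \<circ> \<phi> \<in> D1 \<and> h \<circ> \<phi> \<in> D1 \<and> \<E>2 f h = \<E>1 (f \<circ> \<phi>) (h \<circ> \<phi>))"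

text \<open>
  The function \<open>f\<^sup>2 log f\<^sup>2\<close> need not be integrable for \<open>f \<in> D\<close>, so its integral is taken in the
  extended reals. If the positive part has infinite integral the value is \<open>\<infinity>\<close>, also when the
  negative part has infinite integral as well (\<open>\<infinity> - \<infinity> = \<infinity>\<close> in type \<open>ereal\<close>). Hence a logarithmic
  Sobolev inequality entails that the integral of \<open>f\<^sup>2 log f\<^sup>2\<close> exists in \<open>[-\<infinity>, \<infinity>)\<close>.
\<close>

definition ereal_integral :: "'a measure \<Rightarrow> ('a \<Rightarrow> real) \<Rightarrow> ereal" where
  "ereal_integral M g =
     enn2ereal (\<integral>\<^sup>+x. ennreal (g x) \<partial>M) - enn2ereal (\<integral>\<^sup>+x. ennreal (- g x) \<partial>M)"

text \<open>The convention \<open>0 log 0 = 0\<close> holds automatically, as \<open>0 * ln 0 = 0\<close>.\<close>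

definition log_sobolev ::
  "'a measure \<Rightarrow> 'a bform \<Rightarrow> ('a \<Rightarrow> real) set \<Rightarrow> real \<Rightarrow> bool" where
  "log_sobolev M \<E> D C \<longleftrightarrow>
     (\<forall>f\<in>D. ereal_integral M (\<lambda>x. (f x)\<^sup>2 * ln ((f x)\<^sup>2))
              - ereal ((\<integral>x. (f x)\<^sup>2 \<partial>M) * ln (\<integral>x. (f x)\<^sup>2 \<partial>M))
            \<le> ereal (C * \<E> f f))"

end

theory Submission
  imports Defs
begin

text \<open>Each term of the inequality for \<open>f\<close> on the second space equals the
  corresponding term for the pullback \<open>f \<circ> \<phi>\<close> on the first. The entropy and
  the squared norm transfer by change of variables along the pushforward, the energy by isometry.
  Since \<open>f \<circ> \<phi>\<close> lies in \<open>D1\<close>, the assumed inequality applies to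
  it.\<close>

text \<open>The positive and negative parts are transported separately as nonnegative integrals, so
  infinite values are covered too.\<close>

lemma ereal_integral_distr:
  assumes "T \<in> measurable M N" and "g \<in> borel_measurable N"
  shows "ereal_integral (distr M N T) g = ereal_integral M (g \<circ> T)"
  using assms by (simp add: ereal_integral_def nn_integral_distr)

theorem theorem2p4:
  fixes M1 :: "'a::{t2_space, second_countable_topology} measure"
    and M2 :: "'b::{t2_space, second_countable_topology} measure"
    and \<E>1 :: "'a bform" and D1 :: "('a \<Rightarrow> real) set"
    and \<E>2 :: "'b bform" and D2 :: "('b \<Rightarrow> real) set"
    and \<phi> :: "'a \<Rightarrow> 'b" and C :: real
  assumes "quasi_regular_dirichlet_space M1 \<E>1 D1"
    and "quasi_regular_dirichlet_space M2 \<E>2 D2"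
    and "quasi_homeomorphism M1 \<E>1 D1 M2 \<E>2 D2 \<phi>"
    and "log_sobolev M1 \<E>1 D1 C"
  shows "log_sobolev M2 \<E>2 D2 C"
  unfolding log_sobolev_def
proof
  fix f assume f: "f \<in> D2"
  interpret E2: quasi_regular_dirichlet_space M2 \<E>2 D2 by fact
  have f_meas [measurable]: "f \<in> borel_measurable M2"
    using f E2.dom_L2 by (auto simp: L2_functions_def)
  \<comment> \<open>The isometry of the forms is used on the diagonal, with both arguments equal to
    \<open>f\<close>.\<close>
  have \<phi> [measurable]: "\<phi> \<in> measurable M1 M2" and M2: "M2 = distr M1 M2 \<phi>"
    and dom: "f \<circ> \<phi> \<in> D1" and form: "\<E>2 f f = \<E>1 (f \<circ> \<phi>) (f \<circ> \<phi>)"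
    using assms(3) f by (auto simp: quasi_homeomorphism_def)
  have "ereal_integral M2 (\<lambda>x. (f x)\<^sup>2 * ln ((f x)\<^sup>2))
      = ereal_integral M1 (\<lambda>x. ((f \<circ> \<phi>) x)\<^sup>2 * ln (((f \<circ> \<phi>) x)\<^sup>2))"
    \<comment> \<open>The fact \<open>M2\<close> has \<open>M2\<close> again on its right side,
      where it only supplies the sigma-algebra, so it is rewritten exactly once.\<close>
    by (subst M2, subst ereal_integral_distr) (simp_all add: comp_def)
  moreover have "(\<integral>x. (f x)\<^sup>2 \<partial>M2) = (\<integral>x. ((f \<circ> \<phi>) x)\<^sup>2 \<partial>M1)"
    by (subst M2, subst integral_distr) simp_all
  ultimately show "ereal_integral M2 (\<lambda>x. (f x)\<^sup>2 * ln ((f x)\<^sup>2))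
      - ereal ((\<integral>x. (f x)\<^sup>2 \<partial>M2) * ln (\<integral>x. (f x)\<^sup>2 \<partial>M2)) \<le> ereal (C * \<E>2 f f)"
    using assms(4)[unfolded log_sobolev_def, rule_format, OF dom] form by (simp only:)
qed

end
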